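(* For all $n\in\mathbb{N}$ we have $$\sqrt{2\pi}\left(\frac{n+a_*}{e}\right)^{n+a_*}<n!<\sqrt{2\pi}\left(\frac{n+a^*}{e}\right)^{n+a^*},$$ where the constants $a_*=0.428844044\ldots$ and $a^*=0.5$ are the best possible.
   Context: Here $\mathbb{N}=\{1,2,3,\ldots\}$ and $e$ is the base of the natural logarithm. "Best possible" means that $a_*$ is the largest number $\alpha$ and $a^*$ is the smallest number $\beta$ such that $\sqrt{2\pi}\left(\frac{n+\alpha}{e}\right)^{n+\alpha}<n!<\sqrt{2\pi}\left(\frac{n+\beta}{e}\right)^{n+\beta}$ holds for all $n\in\mathbb{N}$.
   Formalization: The lower bound is proved with "≤", with equality exactly at n = 1 (strict for n ≥ 2): no largest α satisfies the strict bound for all n, so a_* is the supremum of the α for which it holds and the largest α for which the bound with "≤" holds. *)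

theory Defs
  imports "HOL-Analysis.Analysis" "HOL-Library.Lub_Glb"
begin

text \<open>The approximation sqrt (2 pi) ((n + c) / e) ^ (n + c) of n!. For n + c < 0 the value
  depends on the totalisation of \<open>powr\<close>, but a constant c with n + c < 0 for some n \<ge> 1 is below
  both optimal constants, and only the (positive) bases with n = 1, respectively with n large,
  decide the optimality of these.\<close>

definition shifted_stirling :: "real \<Rightarrow> nat \<Rightarrow> real" where
  "shifted_stirling c n = sqrt (2 * pi) * ((real n + c) / exp 1) powr (real n + c)"

end

theory Submission
  imports Defs "HOL-Real_Asymp.Real_Asymp"
begin

text \<open>
  Put \<open>\<phi> x = x ln x - x\<close>, so that \<open>\<phi>' = ln\<close> and the approximation with shift \<open>c\<close> is
  \<open>exp (ln (2 \<pi>) / 2 + \<phi> (n + c))\<close>. How it compares with \<open>n!\<close> is decided by the sign of the excess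
  \<open>E c n = ln n! - ln (2 \<pi>) / 2 - \<phi> (n + c)\<close>.

  The main point is that \<open>E c n\<close> increases with \<open>n\<close> if \<open>c \<le> 1/2\<close> and \<open>n + c > 0\<close>. Its increment is
  \<open>ln (n + 1)\<close> minus the mean of \<open>ln\<close> over the unit interval \<open>[n + c, n + 1 + c]\<close>. For
  \<open>c = 1/2\<close> that interval is centred at \<open>n + 1\<close>, and the mean of the strictly concave function
  \<open>ln\<close> is less than its value at the centre; for a smaller \<open>c\<close> the mean is smaller still
  (\<open>stirling_excess_less_Suc\<close>).

  By Stirling's formula, which is derived here from Wallis' product, \<open>E (1/2) n\<close> tends to \<open>0\<close>
  (\<open>stirling_excess_half_tendsto_0\<close>). As it increases, it is negative, which is the upper bound.
  Since \<open>E c n - E (1/2) n = \<phi> (n + 1/2) - \<phi> (n + c)\<close> grows like \<open>(1/2 - c) ln n\<close>, no shift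
  \<open>c < 1/2\<close> gives an upper bound for all \<open>n\<close> (\<open>stirling_excess_at_top\<close>).

  For the lower bound, monotonicity in \<open>n\<close> leaves \<open>n = 1\<close> as the only critical case: the optimal
  constant is the root \<open>a\<close> of \<open>E a 1 = 0\<close>, that is, of
  \<open>(1 + a) ln (1 + a) - (1 + a) + ln (2 \<pi>) / 2 = 0\<close>. Equality holds at \<open>n = 1\<close>, the inequality is
  strict for \<open>n > 1\<close>, and as \<open>\<phi>\<close> increases on \<open>[1, \<infinity>)\<close>, every larger shift fails at \<open>n = 1\<close>
  while every smaller positive one satisfies the strict inequality for all \<open>n\<close>. Rational bounds
  for \<open>ln\<close> and \<open>\<pi>\<close> give the first nine decimals of \<open>a\<close> (\<open>stirling_excess_one_root\<close>).
\<close>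

section \<open>The logarithmic excess of the factorial\<close>

definition ln_antideriv :: "real \<Rightarrow> real" where
  "ln_antideriv x = x * ln x - x"

definition stirling_excess :: "real \<Rightarrow> nat \<Rightarrow> real" where
  "stirling_excess c n = ln (fact n) - ln (2 * pi) / 2 - ln_antideriv (real n + c)"

text \<open>Positivity of the base \<open>n + c\<close> is what makes \<open>powr\<close> here the usual real power.\<close>

lemma shifted_stirling_eq_exp:
  assumes "real n + c > 0"
  shows "shifted_stirling c n = exp (ln (2 * pi) / 2 + ln_antideriv (real n + c))"
proof -
  have "sqrt (2 * pi) = exp (ln (2 * pi) / 2)"
    by (simp add: ln_sqrt [symmetric])
  thus ?thesis
    using assms
    by (simp add: shifted_stirling_def ln_antideriv_def powr_def ln_div exp_add [symmetric]
        algebra_simps)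
qed

lemma
  assumes "real n + c > 0"
  shows shifted_stirling_less_fact_iff: "shifted_stirling c n < fact n \<longleftrightarrow> stirling_excess c n > 0"
    and fact_less_shifted_stirling_iff: "fact n < shifted_stirling c n \<longleftrightarrow> stirling_excess c n < 0"
proof -
  have "fact n = exp (ln (fact n :: real))"
    by simp
  thus "shifted_stirling c n < fact n \<longleftrightarrow> stirling_excess c n > 0"
    and "fact n < shifted_stirling c n \<longleftrightarrow> stirling_excess c n < 0"
    unfolding shifted_stirling_eq_exp [OF assms] stirling_excess_def
    by (metis exp_less_cancel_iff diff_diff_eq less_iff_diff_less_0 diff_gt_0_iff_gt)+
qed

section \<open>Increments of the antiderivative of the logarithm\<close>

lemma ln_antideriv_has_derivative [derivative_intros]:
  assumes "(f has_field_derivative D) (at x)" "f x > 0"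
  shows "((\<lambda>x. ln_antideriv (f x)) has_field_derivative ln (f x) * D) (at x)"
  unfolding ln_antideriv_def
  by (rule derivative_eq_intros assms refl | use assms(2) in \<open>simp add: algebra_simps\<close>)+

lemma ln_antideriv_strict_mono:
  assumes "1 \<le> x" "x < y"
  shows "ln_antideriv x < ln_antideriv y"
proof (rule DERIV_pos_imp_increasing_open [OF assms(2)])
  fix t assume "x < t" "t < y"
  thus "\<exists>D. (ln_antideriv has_real_derivative D) (at t) \<and> 0 < D"
    using assms by (intro exI [of _ "ln t"] conjI) (auto intro!: derivative_eq_intros)
qed (use assms in \<open>auto simp: ln_antideriv_def intro!: continuous_intros\<close>)

lemma ln_antideriv_increment_mono:
  assumes "0 < x" "x \<le> y"
  shows "ln_antideriv (x + 1) - ln_antideriv x \<le> ln_antideriv (y + 1) - ln_antideriv y"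
proof (rule DERIV_nonneg_imp_nondecreasing [OF assms(2)])
  fix t assume "x \<le> t" "t \<le> y"
  hence t: "t > 0" using assms by simp
  thus "\<exists>D. ((\<lambda>x. ln_antideriv (x + 1) - ln_antideriv x) has_real_derivative D) (at t) \<and> 0 \<le> D"
    by (intro exI [of _ "ln (t + 1) - ln t"] conjI) (auto intro!: derivative_eq_intros)
qed

text \<open>
  Strict concavity: the increment is the mean of \<open>ln\<close> over \<open>[m - 1/2, m + 1/2]\<close>. Letting the
  half-length \<open>t\<close> of the interval grow from \<open>0\<close>, the difference of both sides (scaled by \<open>2 t\<close>)
  has derivative \<open>ln (m + t) + ln (m - t) - 2 ln m\<close>, negative because \<open>m\<^sup>2 - t\<^sup>2 < m\<^sup>2\<close>.
\<close>

lemma ln_antideriv_centred_increment_less: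
  assumes "m > 1 / 2"
  shows "ln_antideriv (m + 1 / 2) - ln_antideriv (m - 1 / 2) < ln m"
proof -
  let ?g = "\<lambda>t. ln_antideriv (m + t) - ln_antideriv (m - t) - 2 * t * ln m"
  have "?g (1 / 2) < ?g 0"
  proof (rule DERIV_neg_imp_decreasing_open [where f = ?g])
    fix t :: real assume t: "0 < t" "t < 1 / 2"
    have "ln ((m + t) * (m - t)) < ln (m * m)"
      using assms t mult_strict_mono [of t m t m]
      by (subst ln_less_cancel_iff) (auto simp: algebra_simps)
    hence "ln (m + t) + ln (m - t) - 2 * ln m < 0"
      using assms t by (simp add: ln_mult)
    thus "\<exists>D. (?g has_real_derivative D) (at t) \<and> D < 0"
      using assms t
      by (intro exI [of _ "ln (m + t) + ln (m - t) - 2 * ln m"] conjI)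
         (auto intro!: derivative_eq_intros)
  qed (use assms in \<open>auto simp: ln_antideriv_def intro!: continuous_intros\<close>)
  thus ?thesis by simp
qed

section \<open>Monotonicity and limit of the excess\<close>

lemma stirling_excess_Suc:
  "stirling_excess c (Suc n) - stirling_excess c n =
     ln (real n + 1) - (ln_antideriv (real n + c + 1) - ln_antideriv (real n + c))"
proof -
  have "ln (fact (Suc n) :: real) = ln (real n + 1) + ln (fact n)"
    by (simp add: ln_mult add.commute)
  thus ?thesis by (simp add: stirling_excess_def algebra_simps)
qed

text \<open>
  Moving the interval \<open>[n + c, n + c + 1]\<close> to the right until it is centred at \<open>n + 1\<close> can only
  increase the mean of \<open>ln\<close>, and the centred mean is below \<open>ln (n + 1)\<close>.
\<close>

lemma stirling_excess_less_Suc: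
  assumes "c \<le> 1 / 2" "real n + c > 0"
  shows "stirling_excess c n < stirling_excess c (Suc n)"
proof -
  have "ln_antideriv (real n + c + 1) - ln_antideriv (real n + c) \<le>
        ln_antideriv (real n + 1 / 2 + 1) - ln_antideriv (real n + 1 / 2)"
    using assms by (intro ln_antideriv_increment_mono) auto
  also have "\<dots> < ln (real n + 1)"
    using ln_antideriv_centred_increment_less [of "real n + 1"] by (simp add: add_ac)
  finally show ?thesis
    using stirling_excess_Suc [of c n] by simp
qed

lemma stirling_excess_strict_mono:
  assumes "c \<le> 1 / 2" "real m + c > 0" "m < n"
  shows "stirling_excess c m < stirling_excess c n"
  using assms(3)
proof (induction n)
  case (Suc n)
  have "stirling_excess c n < stirling_excess c (Suc n)"
    using assms Suc.prems by (intro stirling_excess_less_Suc) auto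
  thus ?case using Suc by (cases "m = n") auto
qed simp

text \<open>For the centred shift, the first-order term of the increments cancels, so that they are
  \<open>O(1/n\<^sup>2)\<close> and hence summable.\<close>

lemma convergent_stirling_excess_half: "convergent (stirling_excess (1 / 2))"
proof -
  have "summable (\<lambda>n. norm (1 / real n ^ 2))"
    using inverse_power_summable [of 2, where 'a = real] by (simp add: inverse_eq_divide)
  moreover have "(\<lambda>n. ln (real n + 1) -
      (ln_antideriv (real n + 1/2 + 1) - ln_antideriv (real n + 1/2))) \<in> O(\<lambda>n. 1 / real n ^ 2)"
    unfolding ln_antideriv_def by real_asymp
  ultimately have "summable (\<lambda>n. stirling_excess (1/2) (Suc n) - stirling_excess (1/2) n)"
    unfolding stirling_excess_Suc by (rule summable_comparison_test_bigo)
  hence "convergent (\<lambda>n. \<Sum>k<n. stirling_excess (1/2) (Suc k) - stirling_excess (1/2) k)"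
    by (simp add: summable_iff_convergent)
  hence "convergent (\<lambda>n. stirling_excess (1/2) n - stirling_excess (1/2) 0)"
    by (simp add: sum_lessThan_telescope)
  thus ?thesis
    by (simp add: convergent_diff_const_right_iff)
qed

lemma wallis_product_closed_form:
  "(\<Prod>k=1..n. (4 * real k ^ 2) / (4 * real k ^ 2 - 1)) =
     2 ^ (4 * n) * fact n ^ 4 / (fact (2 * n) ^ 2 * (2 * real n + 1))"
proof (induction n)
  case (Suc n)
  \<comment> \<open>The induction step as an identity of rational functions, with
     \<open>P = 2\<^sup>4\<^sup>n\<close>, \<open>F = n!\<close>, \<open>G = (2n)!\<close>, \<open>a = 2n + 1\<close>, \<open>b = n + 1\<close>, \<open>d = 2n + 3\<close>.\<close>
  have step: "P * F ^ 4 / (G ^ 2 * a) * (4 * b ^ 2 / (a * d)) =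
      (2 ^ 4 * P) * (b * F) ^ 4 / ((2 * b * a * G) ^ 2 * d)"
    if "a \<noteq> 0" "b \<noteq> 0" "d \<noteq> 0" "G \<noteq> 0" for P F G a b d :: real
    using that by (simp add: divide_simps) (simp add: eval_nat_numeral)
  have "4 * real (Suc n) ^ 2 - 1 = (2 * real n + 1) * (2 * real n + 3)"
    by (simp add: algebra_simps power2_eq_square)
  hence "(\<Prod>k=1..Suc n. (4 * real k ^ 2) / (4 * real k ^ 2 - 1)) =
     2 ^ (4 * n) * fact n ^ 4 / (fact (2 * n) ^ 2 * (2 * real n + 1)) *
       (4 * (real n + 1) ^ 2 / ((2 * real n + 1) * (2 * real n + 3)))"
    using Suc.IH by (simp add: add.commute)
  also have "\<dots> = (2 ^ 4 * 2 ^ (4 * n)) * ((real n + 1) * fact n) ^ 4 /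
      ((2 * (real n + 1) * (2 * real n + 1) * fact (2 * n)) ^ 2 * (2 * real n + 3))"
    by (rule step) (use of_nat_0_le_iff [of n, where 'a = real] in \<open>linarith | simp\<close>)+
  also have "(2 ^ 4 * 2 ^ (4 * n) :: real) = 2 ^ (4 * Suc n)"
    by (simp add: power_add)
  also have "2 * (real n + 1) * (2 * real n + 1) * fact (2 * n) = fact (2 * Suc n)"
    by (simp add: algebra_simps)
  also have "(real n + 1) * fact n = fact (Suc n)"
    by (simp add: algebra_simps)
  also have "2 * real n + 3 = 2 * real (Suc n) + 1"
    by simp
  finally show ?case .
qed simp

text \<open>
  Stirling's formula. In the logarithm \<open>4 ln n! - 2 ln (2n)! + \<dots>\<close> of Wallis' product, the excess
  \<open>E n\<close> with shift \<open>1/2\<close> enters as \<open>4 E n - 2 E (2 n)\<close>, which tends to \<open>2 L\<close> if \<open>L\<close> is the limit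
  of \<open>E\<close>. All other terms already account for the limit \<open>ln (\<pi>/2)\<close>, so \<open>L = 0\<close>.
\<close>

lemma stirling_excess_half_tendsto_0: "stirling_excess (1 / 2) \<longlonglongrightarrow> 0"
proof -
  let ?d = "stirling_excess (1 / 2)"
  obtain L where L: "?d \<longlonglongrightarrow> L"
    using convergent_stirling_excess_half by (auto simp: convergent_def)
  have L2: "(\<lambda>n. ?d (2 * n)) \<longlonglongrightarrow> L"
    by (rule filterlim_compose [OF L]) (auto intro: filterlim_subseq simp: strict_mono_def)
  define r where "r = (\<lambda>n. 4 * real n * ln 2 + 4 * ln_antideriv (real n + 1 / 2)
    - 2 * ln_antideriv (2 * real n + 1 / 2) + ln (2 * pi) - ln (2 * real n + 1))"
  have "ln (\<Prod>k=1..n. (4 * real k ^ 2) / (4 * real k ^ 2 - 1)) = 4 * ?d n - 2 * ?d (2 * n) + r n" for n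
  proof -
    have "ln (\<Prod>k=1..n. (4 * real k ^ 2) / (4 * real k ^ 2 - 1)) =
       4 * real n * ln 2 + 4 * ln (fact n) - (2 * ln (fact (2 * n)) + ln (2 * real n + 1))"
      unfolding wallis_product_closed_form
      by (subst ln_div ln_mult ln_realpow; simp add: ln_mult ln_realpow add_pos_nonneg)+
    thus ?thesis by (simp add: r_def stirling_excess_def algebra_simps)
  qed
  moreover have "(\<lambda>n. ln (\<Prod>k=1..n. (4 * real k ^ 2) / (4 * real k ^ 2 - 1))) \<longlonglongrightarrow> ln (pi / 2)"
    by (intro tendsto_ln wallis) simp
  ultimately have "(\<lambda>n. 4 * ?d n - 2 * ?d (2 * n) + r n) \<longlonglongrightarrow> ln (pi / 2)"
    by simp
  moreover have "(\<lambda>n. 4 * ?d n - 2 * ?d (2 * n) + r n) \<longlonglongrightarrow> 4 * L - 2 * L + ln (pi / 2)"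
  proof (intro tendsto_intros L L2)
    have "(\<lambda>n. 4 * real n * ln 2 + 4 * ln_antideriv (real n + 1 / 2)
       - 2 * ln_antideriv (2 * real n + 1 / 2) - ln (2 * real n + 1)) \<longlonglongrightarrow> - 2 * ln 2"
      unfolding ln_antideriv_def by real_asymp
    from tendsto_add [OF this tendsto_const [of "ln (2 * pi)"]]
    show "r \<longlonglongrightarrow> ln (pi / 2)"
      by (simp add: r_def ln_mult ln_div algebra_simps)
  qed
  ultimately have "ln (pi / 2) = 4 * L - 2 * L + ln (pi / 2)"
    by (rule LIMSEQ_unique)
  with L show ?thesis by simp
qed

lemma stirling_excess_half_neg: "stirling_excess (1 / 2) n < 0"
proof -
  have "stirling_excess (1 / 2) (Suc n) \<le> 0"
  proof (rule LIMSEQ_le_const [OF stirling_excess_half_tendsto_0])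
    show "\<exists>N. \<forall>k\<ge>N. stirling_excess (1 / 2) (Suc n) \<le> stirling_excess (1 / 2) k"
      using stirling_excess_strict_mono [of "1/2" "Suc n"]
      by (intro exI [of _ "Suc n"]) (auto simp: le_less)
  qed
  thus ?thesis
    using stirling_excess_less_Suc [of "1/2" n] by simp
qed

lemma stirling_excess_at_top:
  assumes "c < 1 / 2"
  shows "filterlim (stirling_excess c) at_top sequentially"
proof -
  have "filterlim (\<lambda>n. ln_antideriv (real n + 1 / 2) - ln_antideriv (real n + c)) at_top sequentially"
    using assms unfolding ln_antideriv_def by real_asymp
  from filterlim_tendsto_add_at_top [OF stirling_excess_half_tendsto_0 this]
  moreover have "stirling_excess c = (\<lambda>n. stirling_excess (1 / 2) n +
      (ln_antideriv (real n + 1 / 2) - ln_antideriv (real n + c)))"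
    by (simp add: stirling_excess_def fun_eq_iff)
  ultimately show ?thesis by simp
qed

section \<open>The optimal shift of the lower bound\<close>

text \<open>
  At the endpoints of the interval of length \<open>10\<^sup>-\<^sup>9\<close>, the excess at \<open>n = 1\<close> is about
  \<open>6.6 * 10\<^sup>-\<^sup>1\<^sup>1\<close> and \<open>-2.9 * 10\<^sup>-\<^sup>1\<^sup>0\<close>, so \<open>ln (2 \<pi>) / 2\<close> and the logarithms at the endpoints have to be
  known up to about \<open>10\<^sup>-\<^sup>1\<^sup>1\<close>. They come from partial sums of the series of \<open>ln x\<close> in powers of
  \<open>(x - 1) / (x + 1)\<close>, which converges fast for \<open>x\<close> close to \<open>1\<close>; factoring out a simple fraction
  keeps both the number of terms and the size of the fractions small.
\<close>

lemma ln_5_halves_bounds: "ln (5 / 2 :: real) \<in> {0.91629073187..0.91629073188}"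
  using ln_approx_bounds [of "5/2" 14] by (simp add: lessThan_nat_numeral power_divide)

text \<open>Splitting off \<open>(5/2)\<^sup>2 = 6.25\<close> leaves the logarithm of a number close to \<open>1\<close>, for which two
  terms of the series suffice.\<close>

lemma ln_2pi_bounds: "ln (2 * pi) \<in> {1.83787706639..1.83787706643}"
proof -
  have "ln (2 * pi) = 2 * ln (5 / 2) + ln (2 * pi / (5 / 2) ^ 2)"
    by (subst ln_div) (simp_all add: ln_realpow)
  moreover have "ln (2 * pi / (5 / 2) ^ 2) \<le> 0.00529560267"
  proof -
    have "ln (2 * pi / (5 / 2) ^ 2) \<le> ln 1.00530964915"
      using pi_approx by (subst ln_le_cancel_iff) (auto simp: power2_eq_square)
    also have "\<dots> \<le> 0.00529560267"
      using ln_approx_bounds [of "1.00530964915" 2]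
      by (simp add: lessThan_nat_numeral power_divide)
    finally show ?thesis .
  qed
  moreover have "0.00529560265 \<le> ln (2 * pi / (5 / 2) ^ 2)"
  proof -
    have "0.00529560265 \<le> ln (1.00530964914 :: real)"
      using ln_approx_bounds [of "1.00530964914" 2]
      by (simp add: lessThan_nat_numeral power_divide)
    also have "\<dots> \<le> ln (2 * pi / (5 / 2) ^ 2)"
      using pi_approx by (subst ln_le_cancel_iff) (auto simp: power2_eq_square)
    finally show ?thesis .
  qed
  ultimately show ?thesis
    using ln_5_halves_bounds by simp
qed

text \<open>Both endpoints \<open>1.42884404\<dots>\<close> are close to \<open>10/7 = 1.42857\<dots>\<close>; after division by \<open>10/7\<close> the first
  term of the series is enough.\<close>

lemma ln_10_7_bounds: "ln (10 / 7 :: real) \<in> {0.35667494393..0.35667494394}"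
  using ln_approx_bounds [of "10/7" 7] by (simp add: lessThan_nat_numeral power_divide)

lemma stirling_excess_one_lower_endpoint: "stirling_excess 0.428844044 1 > 0"
proof -
  have "ln (1.428844044 :: real) \<le> 0.35686575654"
  proof -
    have "ln (1.428844044 :: real) = ln (10 / 7 * 1.0001908308)"
      by simp
    also have "\<dots> = ln (10 / 7) + ln 1.0001908308"
      by (rule ln_mult_pos) simp_all
    also have "\<dots> \<le> 0.35686575654"
      using ln_10_7_bounds ln_approx_bounds [of "1.0001908308" 1]
      by (simp add: power_divide)
    finally show ?thesis .
  qed
  moreover have "stirling_excess 0.428844044 1 =
      1.428844044 - ln (2 * pi) / 2 - 1.428844044 * ln 1.428844044"
    by (simp add: stirling_excess_def ln_antideriv_def)
  ultimately show ?thesis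
    using ln_2pi_bounds by simp
qed

lemma stirling_excess_one_upper_endpoint: "stirling_excess 0.428844045 1 < 0"
proof -
  have "ln (1.428844045 :: real) \<ge> 0.35686575722"
  proof -
    have "ln (1.428844045 :: real) = ln (10 / 7 * 1.0001908315)"
      by simp
    also have "\<dots> = ln (10 / 7) + ln 1.0001908315"
      by (rule ln_mult_pos) simp_all
    also have "\<dots> \<ge> 0.35686575722"
      using ln_10_7_bounds ln_approx_bounds [of "1.0001908315" 1]
      by (simp add: power_divide)
    finally show ?thesis .
  qed
  moreover have "stirling_excess 0.428844045 1 =
      1.428844045 - ln (2 * pi) / 2 - 1.428844045 * ln 1.428844045"
    by (simp add: stirling_excess_def ln_antideriv_def)
  ultimately show ?thesis
    using ln_2pi_bounds by simp
qed

lemma stirling_excess_one_root: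
  obtains a where "0.428844044 \<le> a" "a < 0.428844045" "stirling_excess a 1 = 0"
proof -
  note ends = stirling_excess_one_lower_endpoint stirling_excess_one_upper_endpoint
  have "continuous_on {0.428844044..0.428844045} (\<lambda>c. stirling_excess c 1)"
    unfolding stirling_excess_def ln_antideriv_def by (intro continuous_intros) auto
  then obtain a where a: "0.428844044 \<le> a" "a \<le> 0.428844045" "stirling_excess a 1 = 0"
    using IVT2' [of "\<lambda>c. stirling_excess c 1" "0.428844045" 0 "0.428844044"] ends
    by (auto simp del: One_nat_def)
  moreover from a(3) ends(2) have "a \<noteq> 0.428844045" by (metis less_irrefl)
  ultimately show ?thesis by (intro that [of a]) auto
qed

theorem theorem2p1:
  shows "\<exists>a::real.
      0.428844044 \<le> a \<and> a < 0.428844045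
    \<and> (\<forall>n::nat. n \<ge> 1 \<longrightarrow> shifted_stirling a n \<le> fact n \<and> fact n < shifted_stirling 0.5 n)
    \<and> (\<forall>n::nat. n \<ge> 1 \<longrightarrow> (shifted_stirling a n = fact n \<longleftrightarrow> n = 1))
    \<and> isLub UNIV {\<alpha>::real. \<forall>n::nat. n \<ge> 1 \<longrightarrow> shifted_stirling \<alpha> n < fact n} a
    \<and> (\<forall>\<alpha>::real. (\<forall>n::nat. n \<ge> 1 \<longrightarrow> shifted_stirling \<alpha> n \<le> fact n) \<longrightarrow> \<alpha> \<le> a)
    \<and> (\<forall>\<beta>::real. (\<forall>n::nat. n \<ge> 1 \<longrightarrow> fact n < shifted_stirling \<beta> n) \<longrightarrow> 0.5 \<le> \<beta>)"
proof -
  obtain a where a: "0.428844044 \<le> a" "a < 0.428844045" and root: "stirling_excess a 1 = 0"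
    by (rule stirling_excess_one_root)
  have above_root: "stirling_excess a n > 0" if "n > 1" for n
    using stirling_excess_strict_mono [of a 1 n] that a root by simp
  have le_a: "shifted_stirling a n \<le> fact n" if "n \<ge> 1" for n
    using above_root [of n] root that a fact_less_shifted_stirling_iff [of n a]
    by (cases "n = 1") (auto simp: not_less [symmetric])
  have eq_a: "shifted_stirling a n = fact n \<longleftrightarrow> n = 1" if "n \<ge> 1" for n
    using above_root [of n] root that a
      fact_less_shifted_stirling_iff [of n a] shifted_stirling_less_fact_iff [of n a]
    by (cases "n = 1") auto
  have lt_half: "fact n < shifted_stirling 0.5 n" for n
    using stirling_excess_half_neg [of n] fact_less_shifted_stirling_iff [of n "1/2"] by simp
  have le_imp: "\<alpha> \<le> a" if "shifted_stirling \<alpha> 1 \<le> fact 1" for \<alpha>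
  proof (rule ccontr)
    assume "\<not> \<alpha> \<le> a"
    hence "stirling_excess \<alpha> 1 < stirling_excess a 1"
      using ln_antideriv_strict_mono [of "1 + a" "1 + \<alpha>"] a by (simp add: stirling_excess_def)
    thus False
      using that root a \<open>\<not> \<alpha> \<le> a\<close> fact_less_shifted_stirling_iff [of 1 \<alpha>] by simp
  qed
  have lt_fact: "shifted_stirling \<alpha> n < fact n" if "0 < \<alpha>" "\<alpha> < a" "n \<ge> 1" for \<alpha> n
  proof -
    have "shifted_stirling \<alpha> n < shifted_stirling a n"
      using ln_antideriv_strict_mono [of "real n + \<alpha>" "real n + a"] that
      by (simp add: shifted_stirling_eq_exp)
    also have "\<dots> \<le> fact n"
      using that by (intro le_a)
    finally show ?thesis .
  qed
  have lub: "isLub UNIV {\<alpha>. \<forall>n::nat. n \<ge> 1 \<longrightarrow> shifted_stirling \<alpha> n < fact n} a"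
  proof (intro isLubI2 isUbI setleI setgeI ballI)
    fix \<alpha> assume "\<alpha> \<in> {\<alpha>. \<forall>n::nat. n \<ge> 1 \<longrightarrow> shifted_stirling \<alpha> n < fact n}"
    hence "shifted_stirling \<alpha> 1 < fact 1" by blast
    thus "\<alpha> \<le> a" by (intro le_imp less_imp_le)
  next
    fix u assume "u \<in> Collect (isUb UNIV
      {\<alpha>. \<forall>n::nat. n \<ge> 1 \<longrightarrow> shifted_stirling \<alpha> n < fact n})"
    hence u: "\<alpha> \<le> u" if "0 < \<alpha>" "\<alpha> < a" for \<alpha>
      using lt_fact that by (auto simp: isUb_def setle_def)
    \<comment> \<open>\<open>a\<close> is not in the set, because equality holds at \<open>n = 1\<close>, but all of \<open>(0, a)\<close> is.\<close>
    show "a \<le> u"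
    proof (rule dense_le_bounded [of 0])
      show "0 < a" using a by simp
    qed (rule u)
  qed simp
  have half_le: "0.5 \<le> \<beta>" if "\<forall>n::nat. n \<ge> 1 \<longrightarrow> fact n < shifted_stirling \<beta> n" for \<beta>
  proof (rule ccontr)
    assume "\<not> 0.5 \<le> \<beta>"
    hence "filterlim (stirling_excess \<beta>) at_top sequentially"
      by (intro stirling_excess_at_top) simp
    hence "eventually (\<lambda>n. stirling_excess \<beta> n > 0) sequentially"
      by (simp add: filterlim_at_top_dense)
    moreover have "eventually (\<lambda>n. real n + \<beta> > 0) sequentially"
      by real_asymp
    ultimately have "eventually (\<lambda>n. n \<ge> 1 \<and> shifted_stirling \<beta> n < fact n) sequentially"
      using eventually_ge_at_top [of 1]
      by eventually_elim (simp add: shifted_stirling_less_fact_iff)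
    then obtain n where "n \<ge> 1" "shifted_stirling \<beta> n < fact n"
      by (auto simp: eventually_sequentially)
    with that show False by (meson less_asym)
  qed
  show ?thesis
    using a le_a eq_a lt_half lub le_imp half_le by (intro exI [of _ a]) auto
qed

end
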